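(* For every $n\ge 0$, the number of simsun permutations of length $n$ that avoid the pattern $213$ is the Motzkin number $M_n$: $$|\mathcal{RS}_n(213)|=M_n.$$
   Context: $\mathfrak{S}_n$ is the set of permutations of $\{1,\dots,n\}$, written in one-line notation $\pi=\pi_1\pi_2\dots\pi_n$ ($\mathfrak{S}_0$ consists of the empty permutation). A permutation $\pi\in\mathfrak{S}_n$ is simsun if for every $3\le k\le n$, the subword of $\pi_1\pi_2\dots\pi_n$ consisting of the entries in $\{1,\dots,k\}$ (kept in their order) has no double descent, i.e. no three entries that are consecutive in that subword and in decreasing order. A permutation $\pi\in\mathfrak{S}_n$ avoids the pattern $\sigma\in\mathfrak{S}_k$ if there are no indices $i_1<i_2<\dots<i_k$ such that $\pi_{i_1}\pi_{i_2}\dots\pi_{i_k}$ is in the same relative order as $\sigma$. $\mathcal{RS}_n(\sigma)$ is the set of simsun permutations in $\mathfrak{S}_n$ avoiding $\sigma$. The Motzkin number $M_n$ is the number of lattice paths from $(0,0)$ to $(n,0)$ with steps $(1,1)$, $(1,-1)$, $(1,0)$ that never go below the $x$-axis; equivalently $\sum_{n\ge0} M_n z^n = \frac{1-z-\sqrt{1-2z-3z^2}}{2z^2}$. *)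

theory Defs
  imports "HOL-Combinatorics.Multiset_Permutations" "HOL-Library.Product_Plus"
begin

(* A permutation of {1..n} is its one-line word, an element of permutations_of_set {1..n};
   the entry pi_i is the list element at position i - 1. *)

definition has_double_descent :: "nat list \<Rightarrow> bool" where
  "has_double_descent w \<longleftrightarrow>
     (\<exists>i. i + 2 < length w \<and> w ! i > w ! (i + 1) \<and> w ! (i + 1) > w ! (i + 2))"

definition simsun :: "nat list \<Rightarrow> bool" where
  "simsun w \<longleftrightarrow>
     (\<forall>k\<in>{3..length w}. \<not> has_double_descent (filter (\<lambda>x. x \<in> {1..k}) w))"

definition contains_pattern :: "nat list \<Rightarrow> nat list \<Rightarrow> bool" where
  "contains_pattern w p \<longleftrightarrow>
     (\<exists>f. strict_mono_on {..<length p} f \<and> f ` {..<length p} \<subseteq> {..<length w} \<and>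
          (\<forall>a<length p. \<forall>b<length p. w ! f a < w ! f b \<longleftrightarrow> p ! a < p ! b))"

definition avoids :: "nat list \<Rightarrow> nat list \<Rightarrow> bool" where
  "avoids w p \<longleftrightarrow> \<not> contains_pattern w p"

definition RS :: "nat \<Rightarrow> nat list \<Rightarrow> nat list set" where
  "RS n p = {w \<in> permutations_of_set {1..n}. simsun w \<and> avoids w p}"

(* A path is the list of its steps; the sum of the first j steps is the point reached after
   j steps from the origin. Every step has horizontal component 1, so a path to (n, 0) has
   exactly n steps and the set of paths is finite. *)
definition motzkin_paths :: "nat \<Rightarrow> (int \<times> int) list set" where
  "motzkin_paths n =
     {s. set s \<subseteq> {(1, 1), (1, - 1), (1, 0)} \<and> sum_list s = (int n, 0) \<and>
         (\<forall>j\<le>length s. snd (sum_list (take j s)) \<ge> 0)}"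

definition motzkin :: "nat \<Rightarrow> nat" where
  "motzkin n = card (motzkin_paths n)"

end

theory Submission
  imports Defs "HOL-Library.Sublist"
begin

text \<open>
  Cut a permutation at its least entry, \<open>w = A @ m # B\<close>.  An entry \<open>a\<close> of \<open>A\<close> and a larger
  entry \<open>b\<close> of \<open>B\<close> would form the pattern 213 with \<open>m\<close> between them, so \<open>w\<close> avoids 213 exactly
  when \<open>A\<close> and \<open>B\<close> do and every entry of \<open>A\<close> exceeds every entry of \<open>B\<close>
  (\<open>avoids_213_split\<close>); the word is then determined by the length of \<open>B\<close> and the relative
  orders of \<open>A\<close> and \<open>B\<close>.

  The simsun condition respects the cut as well.  In a subword of small entries, \<open>m\<close> is followed
  by an ascent or by nothing, so a double descent lies either in the part from \<open>B\<close> or in the part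
  from \<open>A @ [m]\<close>.  Hence \<open>B\<close> may be any simsun word, while \<open>A\<close> must stay simsun when a smaller
  entry is appended (\<open>simsun_word_split\<close>).  Let \<open>p n\<close> count the 213-avoiding simsun words of
  length \<open>n\<close> and \<open>q n\<close> those that stay simsun with a smaller entry \<open>s\<close>, a sentinel, at the end.
  Then \<open>p (n + 1)\<close> is the sum of \<open>q (n - i) * p i\<close> over all \<open>i \<le> n\<close>, \<open>i\<close> being the length
  of \<open>B\<close>.

  Cutting \<open>A @ m # B @ [s]\<close> gives the same rule for \<open>q\<close> if \<open>B\<close> is not empty, with \<open>q i\<close> in
  place of \<open>p i\<close>.  If \<open>B\<close> is empty, the last entry of \<open>A\<close> would begin a double descent ending in
  \<open>m\<close> and \<open>s\<close>, so \<open>A\<close> is empty too.  Thus \<open>q 0 = q 1 = 1\<close>, and \<open>q (n + 2)\<close> is the sum of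
  \<open>q (n - i) * q (i + 1)\<close> over \<open>i \<le> n\<close>.

  The Motzkin numbers satisfy \<open>M (n + 1) = M n + (\<Sum>i<n. M i * M (n - 1 - i))\<close>
  (\<open>motzkin_Suc\<close>).  Together with the recurrences above this yields \<open>q (n + 1) = M n\<close> and then
  \<open>p n = M n\<close> by induction.
\<close>

section \<open>Motzkin paths\<close>

definition steps :: "(int \<times> int) set" where
  "steps = {(1, 1), (1, - 1), (1, 0)}"

text \<open>
  These are the nonnegative paths from height \<open>h\<close> down to the axis in \<open>n\<close> steps, with vertical
  coordinates shifted by \<open>h\<close> so that the path starts at the origin.  Arbitrary starting heights
  are needed because deleting the first step of a path changes the height.
\<close>

definition descending_paths :: "nat \<Rightarrow> nat \<Rightarrow> (int \<times> int) list set" where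
  "descending_paths h n =
     {s. set s \<subseteq> steps \<and> sum_list s = (int n, - int h) \<and>
         (\<forall>j\<le>length s. int h + snd (sum_list (take j s)) \<ge> 0)}"

lemma motzkin_eq_descending: "motzkin n = card (descending_paths 0 n)"
  by (simp add: motzkin_def motzkin_paths_def descending_paths_def steps_def)

lemma fst_sum_list_steps: "set s \<subseteq> steps \<Longrightarrow> fst (sum_list s) = int (length s)"
  by (induction s) (auto simp: steps_def)

lemma length_descending_paths: "s \<in> descending_paths h n \<Longrightarrow> length s = n"
  using fst_sum_list_steps[of s] unfolding descending_paths_def
  by (metis (mono_tags, lifting) fst_conv mem_Collect_eq of_nat_eq_iff)

lemma finite_descending_paths: "finite (descending_paths h n)"
proof (rule finite_subset)
  show "descending_paths h n \<subseteq> {s. set s \<subseteq> steps \<and> length s = n}"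
  proof (rule subsetI)
    fix s assume "s \<in> descending_paths h n"
    then show "s \<in> {s. set s \<subseteq> steps \<and> length s = n}"
      unfolding descending_paths_def
      using length_descending_paths[unfolded descending_paths_def] by blast
  qed
  show "finite {s. set s \<subseteq> steps \<and> length s = n}"
    by (rule finite_lists_length_eq) (simp add: steps_def)
qed

lemma descending_paths_0: "descending_paths h 0 = (if h = 0 then {[]} else {})"
proof -
  have "s \<in> descending_paths h 0 \<longleftrightarrow> s = [] \<and> h = 0" for s
    using length_descending_paths[of s h 0]
    by (auto simp: descending_paths_def zero_prod_def)
  then show ?thesis by auto
qed

lemma all_le_Suc_split: "(\<forall>j\<le>Suc n. P j) \<longleftrightarrow> P 0 \<and> (\<forall>j\<le>n. P (Suc j))"
  by (metis Suc_le_mono not0_implies_Suc le0)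

lemma Cons_in_descending_paths:
  "x # s \<in> descending_paths h (Suc n) \<longleftrightarrow>
     x = (1, 1) \<and> s \<in> descending_paths (Suc h) n \<or>
     x = (1, 0) \<and> s \<in> descending_paths h n \<or>
     x = (1, - 1) \<and> 0 < h \<and> s \<in> descending_paths (h - 1) n"
proof -
  (* The nonnegativity condition includes the starting height, which excludes a down step at 0. *)
  have start: "(\<forall>j\<le>length s. 0 \<le> c + snd (sum_list (take j s))) \<Longrightarrow> 0 \<le> c" for c :: int
    by (drule spec[of _ 0]) simp
  show ?thesis
  proof (cases "x \<in> steps")
    case False
    then show ?thesis by (auto simp: descending_paths_def steps_def)
  next
    case True
    then consider "x = (1, 1)" | "x = (1, 0)" | "x = (1, - 1)" by (auto simp: steps_def)
    then show ?thesis
    proof cases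
      case 3
      then show ?thesis
        using start[of "int h - 1"]
        by (cases "h = 0"; cases "sum_list s")
           (auto simp: descending_paths_def steps_def all_le_Suc_split algebra_simps of_nat_diff)
    qed (cases "sum_list s"; auto simp: descending_paths_def steps_def all_le_Suc_split algebra_simps)+
  qed
qed

lemma descending_paths_Suc:
  "descending_paths h (Suc n) =
     Cons (1, 1) ` descending_paths (Suc h) n \<union> Cons (1, 0) ` descending_paths h n \<union>
     (if h = 0 then {} else Cons (1, - 1) ` descending_paths (h - 1) n)"
proof -
  have "s \<noteq> []" if "s \<in> descending_paths h (Suc n)" for s
    using length_descending_paths[OF that] by auto
  then have "s \<in> descending_paths h (Suc n) \<longleftrightarrow>
     s \<in> Cons (1, 1) ` descending_paths (Suc h) n \<union> Cons (1, 0) ` descending_paths h n \<union>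
     (if h = 0 then {} else Cons (1, - 1) ` descending_paths (h - 1) n)" for s
    by (cases s) (auto simp: Cons_in_descending_paths)
  then show ?thesis by blast
qed

lemma card_descending_paths_Suc:
  "card (descending_paths h (Suc n)) =
     card (descending_paths (Suc h) n) + card (descending_paths h n) +
     (if h = 0 then 0 else card (descending_paths (h - 1) n))"
  unfolding descending_paths_Suc
  by (subst card_Un_disjoint; (subst card_Un_disjoint)?)
     (auto simp: finite_descending_paths card_image)

text \<open>
  A path from height \<open>a + b + 1\<close> has a first down step from \<open>b + 1\<close> to \<open>b\<close>.  Before it the path
  stays at height at least \<open>b + 1\<close>, so there it is a path from \<open>a\<close> to \<open>0\<close> lifted by \<open>b + 1\<close>;
  after it comes a path from \<open>b\<close>.  The proof needs no bijection: both sides satisfy the recurrence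
  obtained by deleting the first step.  Since that step may raise \<open>a\<close>, the induction has to be over
  all \<open>a\<close>, although only \<open>a = b = 0\<close> is wanted in the end.
\<close>

lemma card_descending_paths_add:
  "card (descending_paths (a + b + 1) n) =
     (\<Sum>i<n. card (descending_paths a i) * card (descending_paths b (n - 1 - i)))"
proof (induction n arbitrary: a b)
  case 0
  then show ?case by (simp add: descending_paths_0)
next
  case (Suc n)
  let ?W = "\<lambda>h n. card (descending_paths h n)"
  have "(\<Sum>i<Suc n. ?W a i * ?W b (Suc n - 1 - i)) =
        ?W a 0 * ?W b n + (\<Sum>i<n. ?W a (Suc i) * ?W b (n - 1 - i))"
    by (simp add: sum.lessThan_Suc_shift del: sum.lessThan_Suc)
  also have "(\<Sum>i<n. ?W a (Suc i) * ?W b (n - 1 - i)) =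
      (\<Sum>i<n. ?W (Suc a) i * ?W b (n - 1 - i)) + (\<Sum>i<n. ?W a i * ?W b (n - 1 - i)) +
      (if a = 0 then 0 else \<Sum>i<n. ?W (a - 1) i * ?W b (n - 1 - i))"
    by (simp add: card_descending_paths_Suc sum.distrib algebra_simps)
  also have "\<dots> = ?W (a + b + 2) n + ?W (a + b + 1) n + (if a = 0 then 0 else ?W (a + b) n)"
    using Suc.IH[of "Suc a" b] Suc.IH[of a b] Suc.IH[of "a - 1" b] by (cases a) simp_all
  also have "?W a 0 * ?W b n = (if a = 0 then ?W (a + b) n else 0)"
    by (simp add: descending_paths_0)
  finally show ?case by (simp add: card_descending_paths_Suc)
qed

lemma motzkin_0: "motzkin 0 = 1"
  by (simp add: motzkin_eq_descending descending_paths_0)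

lemma motzkin_Suc:
  "motzkin (Suc n) = motzkin n + (\<Sum>i<n. motzkin i * motzkin (n - 1 - i))"
  using card_descending_paths_add[of 0 0 n]
  by (simp add: motzkin_eq_descending card_descending_paths_Suc)

section \<open>Words avoiding 213\<close>

lemma subseq_nth3:
  assumes "i < j" "j < k" "k < length w"
  shows "subseq [w ! i, w ! j, w ! k] w"
proof -
  have "subseq [w ! k] (drop (Suc j) w)"
    using assms by (auto simp: in_set_conv_nth subseq_singleton_left intro!: exI[of _ "k - Suc j"])
  then have "subseq [w ! j, w ! k] (drop j w)"
    using assms by (simp flip: Cons_nth_drop_Suc)
  moreover have "suffix (drop j w) (drop (Suc i) w)"
    using assms by (metis Suc_leI le_add_diff_inverse suffix_drop drop_drop add.commute)
  ultimately have "subseq [w ! j, w ! k] (drop (Suc i) w)"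
    using suffix_imp_subseq subseq_order.trans by blast
  then have "subseq [w ! i, w ! j, w ! k] (drop i w)"
    using assms by (simp flip: Cons_nth_drop_Suc)
  then show ?thesis
    using subseq_order.trans suffix_drop suffix_imp_subseq by blast
qed

text \<open>
  Subsequences of a concatenation split into subsequences of its parts, which makes this form easier
  to cut than the one with an index embedding.
\<close>

lemma avoids_213_iff:
  "avoids w [2, 1, 3] \<longleftrightarrow> (\<forall>a b c. subseq [b, a, c] w \<longrightarrow> \<not> (a < b \<and> b < c))"
proof (intro iffI allI impI notI)
  fix a b c assume av: "avoids w [2, 1, 3]" and sub: "subseq [b, a, c] w" and less: "a < b \<and> b < c"
  obtain p q r s where w: "w = p @ b # q @ a # r @ c # s"
  proof -
    obtain p u where u: "w = p @ b # u" "subseq [a, c] u"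
      using list_emb_ConsD[OF sub] by auto
    obtain q v where v: "u = q @ a # v" "subseq [c] v"
      using list_emb_ConsD[OF u(2)] by auto
    obtain r s where "v = r @ c # s"
      using list_emb_ConsD[OF v(2)] by auto
    then show ?thesis using that u(1) v(1) by simp
  qed
  define f where "f = (\<lambda>t::nat. if t = 0 then length p else if t = 1 then length p + 1 + length q
    else length p + 1 + length q + 1 + length r)"
  have f: "f 0 = length p" "f (Suc 0) = length p + 1 + length q"
    "f (Suc (Suc 0)) = length p + 1 + length q + 1 + length r"
    by (simp_all add: f_def)
  have nth: "w ! f 0 = b" "w ! f (Suc 0) = a" "w ! f (Suc (Suc 0)) = c"
    unfolding f w by (simp_all add: nth_append)
  have "contains_pattern w [2, 1, 3]"
    unfolding contains_pattern_def
  proof (intro exI[of _ f] conjI)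
    have dom: "{..<length [2, 1, 3::nat]} = {0, Suc 0, Suc (Suc 0)}" by auto
    show "strict_mono_on {..<length [2, 1, 3::nat]} f"
      unfolding dom by (auto simp: strict_mono_on_def f)
    from dom show "f ` {..<length [2, 1, 3::nat]} \<subseteq> {..<length w}"
      by (simp add: f w)
    show "\<forall>u<length [2, 1, 3]. \<forall>v<length [2, 1, 3].
        (w ! f u < w ! f v) = ([2, 1, 3::nat] ! u < [2, 1, 3] ! v)"
      using less by (auto simp: less_Suc_eq nth numeral_2_eq_2 numeral_3_eq_3)
  qed
  then show False using av by (simp add: avoids_def)
next
  assume none: "\<forall>a b c. subseq [b, a, c] w \<longrightarrow> \<not> (a < b \<and> b < c)"
  show "avoids w [2, 1, 3]"
    unfolding avoids_def contains_pattern_def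
  proof clarify
    fix f assume mono: "strict_mono_on {..<length [2, 1, 3::nat]} f"
      and sub: "f ` {..<length [2, 1, 3::nat]} \<subseteq> {..<length w}"
      and order: "\<forall>u<length [2, 1, 3]. \<forall>v<length [2, 1, 3].
        (w ! f u < w ! f v) = ([2, 1, 3::nat] ! u < [2, 1, 3] ! v)"
    have "f 0 < f 1" "f 1 < f 2"
      by (rule strict_mono_onD[OF mono]; simp)+
    moreover have "f 2 < length w"
      by (rule lessThan_iff[THEN iffD1], rule subsetD[OF sub], rule imageI) simp
    ultimately have "subseq [w ! f 0, w ! f 1, w ! f 2] w"
      by (rule subseq_nth3)
    moreover have "w ! f 1 < w ! f 0" "w ! f 0 < w ! f 2"
      using order[rule_format, of 1 0] order[rule_format, of 0 2] by auto
    ultimately show False using none by blast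
  qed
qed

text \<open>
  For the converse direction, suppose \<open>b, a, c\<close> is a pattern 213 in the whole word.  Its first
  letter is not the minimum \<open>x\<close>, so it lies in \<open>A\<close> or \<open>B\<close>; if it lies in \<open>A\<close>, the larger letter
  \<open>c\<close> cannot come from \<open>x # B\<close>, whose letters are all smaller than \<open>b\<close>.
\<close>

lemma avoids_213_split:
  assumes "\<forall>y\<in>set A \<union> set B. x < y" and "set A \<inter> set B = {}"
  shows "avoids (A @ x # B) [2, 1, 3] \<longleftrightarrow>
    (\<forall>a\<in>set A. \<forall>b\<in>set B. b < a) \<and> avoids A [2, 1, 3] \<and> avoids B [2, 1, 3]"
proof (intro iffI conjI ballI)
  assume av: "avoids (A @ x # B) [2, 1, 3]"
  show "avoids A [2, 1, 3]" "avoids B [2, 1, 3]"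
    using av unfolding avoids_213_iff
    by (meson list_emb_append2 list_emb_prefix list_emb_Cons)+
  fix a b assume ab: "a \<in> set A" "b \<in> set B"
  then have "subseq ([a] @ [x, b]) (A @ x # B)"
    by (intro list_emb_append_mono) (auto simp: subseq_singleton_left)
  then show "b < a"
    using av ab assms unfolding avoids_213_iff
    by (metis IntI UnCI append_Cons append_Nil empty_iff linorder_neqE_nat)
next
  assume R: "(\<forall>a\<in>set A. \<forall>b\<in>set B. b < a) \<and> avoids A [2, 1, 3] \<and> avoids B [2, 1, 3]"
  show "avoids (A @ x # B) [2, 1, 3]"
    unfolding avoids_213_iff
  proof (intro allI impI notI)
    fix a b c assume sub: "subseq [b, a, c] (A @ x # B)" and less: "a < b \<and> b < c"
    obtain u v where uv: "[b, a, c] = u @ v" "subseq u A" "subseq v (x # B)"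
      using sub by (meson subseq_appendE)
    have mem: "set u \<subseteq> set A" "set v \<subseteq> insert x (set B)"
      using uv(2,3) set_nths_subset subseq_conv_nths by (metis list.set(2))+
    consider "u = []" "v = [b, a, c]" | "u = [b, a, c]" | "b \<in> set u" "c \<in> set v"
      using uv(1) by (auto simp: Cons_eq_append_conv)
    then show False
    proof cases
      case 1
      then have "a \<in> insert x (set B)" using mem(2) by auto
      then have "b \<noteq> x" using less assms(1) by (metis UnI2 insertE less_asym less_irrefl)
      then have "subseq [b, a, c] B" using uv(3) 1 by simp
      then show False using R less avoids_213_iff by blast
    next
      case 2
      then show False using R less uv(2) avoids_213_iff by blast
    next
      case 3
      then show False using R less mem assms(1) by (metis UnI1 insertE less_asym subsetD)
    qed
  qed
qed

text \<open>
  The parts of a word cut at its minimum are again permutations of intervals.  Letting the interval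
  start anywhere avoids standardising them.
\<close>

definition avoiders :: "nat \<Rightarrow> nat \<Rightarrow> nat list set" where
  "avoiders m n = {w \<in> permutations_of_set {m..<m + n}. avoids w [2, 1, 3]}"

lemma finite_avoiders: "finite (avoiders m n)"
  by (simp add: avoiders_def)

lemma avoidersD: "w \<in> avoiders m n \<Longrightarrow> set w = {m..<m + n} \<and> distinct w \<and> length w = n"
  by (auto simp: avoiders_def permutations_of_set_def dest: distinct_card)

lemma avoiders_0: "avoiders m 0 = {[]}"
  by (auto simp: avoiders_def avoids_def contains_pattern_def)

lemma interval_split:
  fixes X Y :: "nat set"
  assumes "X \<union> Y = {a..<a + n}" and "\<forall>x\<in>X. \<forall>y\<in>Y. y < x"
  shows "Y = {a..<a + card Y} \<and> X = {a + card Y..<a + n} \<and> card Y \<le> n"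
proof -
  define c where "c = (if X = {} then a + n else Min X)"
  have fin: "finite X"
    by (rule finite_subset[of _ "{a..<a + n}"]) (use assms(1) in auto)
  have X: "x \<in> X \<Longrightarrow> c \<le> x" for x
    using fin by (auto simp: c_def)
  have Y: "y < c" if "y \<in> Y" for y
    using that assms fin Min_in[of X] by (auto simp: c_def)
  have c: "a \<le> c" "c \<le> a + n"
  proof -
    have "c \<in> {a..<a + n}" if "X \<noteq> {}"
      using that fin Min_in[of X] unfolding c_def assms(1)[symmetric] by simp
    then show "a \<le> c" "c \<le> a + n" by (cases "X = {}"; simp add: c_def)+
  qed
  have un: "x \<in> X \<or> x \<in> Y \<longleftrightarrow> a \<le> x \<and> x < a + n" for x
    using assms(1) by (metis Un_iff atLeastLessThan_iff)
  have "Y = {a..<c}" "X = {c..<a + n}"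
    unfolding set_eq_iff atLeastLessThan_iff using un X Y c
    by (meson leD le_trans less_le_trans not_le)+
  then show ?thesis using c by simp
qed

lemma avoiders_Suc_iff:
  "w \<in> avoiders m (Suc n) \<longleftrightarrow>
     (\<exists>i\<le>n. \<exists>A\<in>avoiders (Suc m + i) (n - i). \<exists>B\<in>avoiders (Suc m) i. w = A @ m # B)"
proof
  assume w: "w \<in> avoiders m (Suc n)"
  then have ws: "set w = {m..<m + Suc n}" "distinct w" "avoids w [2, 1, 3]"
    using avoidersD[OF w] w by (simp_all add: avoiders_def)
  then have "m \<in> set w" by simp
  then obtain A B where AB: "w = A @ m # B" by (metis split_list)
  have un: "set A \<union> set B = {Suc m..<Suc m + n}"
  proof -
    have "set A \<union> set B = set w - {m}" using ws(2) AB by auto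
    also have "\<dots> = {Suc m..<Suc m + n}" unfolding ws(1) by auto
    finally show ?thesis .
  qed
  then have "\<forall>y\<in>set A \<union> set B. m < y" by auto
  moreover have "set A \<inter> set B = {}" using ws(2) AB by auto
  ultimately have split: "(\<forall>a\<in>set A. \<forall>b\<in>set B. b < a)" "avoids A [2, 1, 3]" "avoids B [2, 1, 3]"
    using avoids_213_split[of A B m] ws(3) AB by auto
  (* All of B lies below all of A, so B takes an initial segment of the remaining values. *)
  let ?i = "card (set B)"
  have seg: "set B = {Suc m..<Suc m + ?i}" "set A = {Suc m + ?i..<Suc m + n}" "?i \<le> n"
    using interval_split[OF un split(1)] by blast+
  have "A \<in> avoiders (Suc m + ?i) (n - ?i)" "B \<in> avoiders (Suc m) ?i"
    using seg split(2,3) ws(2) AB by (auto simp: avoiders_def permutations_of_set_def)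
  then show "\<exists>i\<le>n. \<exists>A\<in>avoiders (Suc m + i) (n - i). \<exists>B\<in>avoiders (Suc m) i. w = A @ m # B"
    using AB seg(3) by blast
next
  assume "\<exists>i\<le>n. \<exists>A\<in>avoiders (Suc m + i) (n - i). \<exists>B\<in>avoiders (Suc m) i. w = A @ m # B"
  then obtain i A B where i: "i \<le> n" and A: "A \<in> avoiders (Suc m + i) (n - i)"
    and B: "B \<in> avoiders (Suc m) i" and w: "w = A @ m # B" by blast
  have "avoids w [2, 1, 3]"
    unfolding w using avoidersD[OF A] avoidersD[OF B] A B
    by (subst avoids_213_split) (auto simp: avoiders_def)
  then show "w \<in> avoiders m (Suc n)"
    using avoidersD[OF A] avoidersD[OF B] i
    by (auto simp: avoiders_def permutations_of_set_def w)
qed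

text \<open>
  The counting form of the cut at the minimum, for every property \<open>R\<close> that splits into separate
  conditions on the two parts.  The conditions may depend on the length \<open>i\<close> of the second part,
  because with a sentinel the case of an empty second part is special.
\<close>

lemma card_avoiders_Suc:
  assumes "\<And>i A B. i \<le> n \<Longrightarrow> A \<in> avoiders (Suc m + i) (n - i) \<Longrightarrow> B \<in> avoiders (Suc m) i \<Longrightarrow>
             R (A @ m # B) \<longleftrightarrow> R1 i A \<and> R2 i B"
  shows "card {w \<in> avoiders m (Suc n). R w} =
    (\<Sum>i\<le>n. card {A \<in> avoiders (Suc m + i) (n - i). R1 i A} * card {B \<in> avoiders (Suc m) i. R2 i B})"
proof -
  let ?S = "\<lambda>i. {A \<in> avoiders (Suc m + i) (n - i). R1 i A} \<times> {B \<in> avoiders (Suc m) i. R2 i B}"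
  let ?f = "\<lambda>(i, A, B). A @ m # B"
  have "{w \<in> avoiders m (Suc n). R w} = ?f ` Sigma {..n} ?S"
    using assms by (auto simp: avoiders_Suc_iff image_iff)+
  moreover have "inj_on ?f (Sigma {..n} ?S)"
  proof (rule inj_onI)
    fix p q assume pq: "p \<in> Sigma {..n} ?S" "q \<in> Sigma {..n} ?S" "?f p = ?f q"
    obtain i A B j C D where p: "p = (i, A, B)" and q: "q = (j, C, D)"
      by (metis prod_cases3)
    from pq have in1: "A \<in> avoiders (Suc m + i) (n - i)" "B \<in> avoiders (Suc m) i"
      and in2: "C \<in> avoiders (Suc m + j) (n - j)" "D \<in> avoiders (Suc m) j"
      and eq: "A @ m # B = C @ m # D"
      by (auto simp: p q)
    have "m \<notin> set A" "m \<notin> set C" "m \<notin> set B" "m \<notin> set D"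
      using in1 in2 by (auto dest!: avoidersD)
    then have "A = C \<and> B = D"
      using eq by (simp add: append_Cons_eq_iff)
    moreover have "i = length B" "j = length D"
      using avoidersD[OF in1(2)] avoidersD[OF in2(2)] by simp_all
    ultimately show "p = q" by (simp add: p q)
  qed
  ultimately have "card {w \<in> avoiders m (Suc n). R w} = card (Sigma {..n} ?S)"
    by (simp add: card_image)
  also have "\<dots> = (\<Sum>i\<le>n. card (?S i))"
    by (subst card_SigmaI) (auto simp: finite_avoiders)
  finally show ?thesis by (simp add: card_cartesian_product)
qed

section \<open>Double descents\<close>

lemma has_double_descent_short: "length w < 3 \<Longrightarrow> \<not> has_double_descent w"
  by (auto simp: has_double_descent_def)

lemma has_double_descent_Cons:
  "has_double_descent (x # y # z # w) \<longleftrightarrow> x > y \<and> y > z \<or> has_double_descent (y # z # w)"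
proof -
  have ex: "(\<exists>i. P i) \<longleftrightarrow> P 0 \<or> (\<exists>i. P (Suc i))" for P :: "nat \<Rightarrow> bool"
    by (metis not0_implies_Suc)
  show ?thesis
    unfolding has_double_descent_def by (subst ex) simp
qed

text \<open>No double descent contains an ascent, so an ascent separates the word into independent parts.\<close>

lemma has_double_descent_ascent:
  assumes "x < y"
  shows "has_double_descent (u @ x # y # v) \<longleftrightarrow>
    has_double_descent (u @ [x]) \<or> has_double_descent (y # v)"
proof (induction u)
  case Nil
  then show ?case using assms
    by (cases v) (auto simp: has_double_descent_short has_double_descent_Cons)
next
  case (Cons a u)
  then show ?case using assms
    by (cases u; cases "tl u")
       (auto simp: has_double_descent_short has_double_descent_Cons)
qed

text \<open>
  The simsun property without bounds on \<open>k\<close> or on the letters, so that it also applies to the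
  parts \<open>A\<close> and \<open>B\<close>, whose letters need not form an interval starting at \<open>1\<close>.
\<close>

definition simsun_word :: "nat list \<Rightarrow> bool" where
  "simsun_word w \<longleftrightarrow> (\<forall>k. \<not> has_double_descent (filter (\<lambda>x. x \<le> k) w))"

text \<open>
  The additional values of \<open>k\<close> impose nothing new: below \<open>3\<close> the subword is too short for a
  double descent, and above \<open>n\<close> it is the whole word.
\<close>

lemma simsun_iff_simsun_word:
  assumes "w \<in> permutations_of_set {1..n}"
  shows "simsun w \<longleftrightarrow> simsun_word w"
proof -
  have w: "set w = {1..n}" "distinct w" "length w = n"
    using assms by (auto simp: permutations_of_set_def dest: distinct_card)
  have filt: "filter (\<lambda>x. x \<in> {1..k}) w = filter (\<lambda>x. x \<le> k) w" for k
    by (rule filter_cong) (use w in auto)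
  have "\<not> has_double_descent (filter (\<lambda>x. x \<le> k) w)" if "simsun w" for k
  proof (cases "k < 3")
    case True
    have "length (filter (\<lambda>x. x \<le> k) w) = card (set (filter (\<lambda>x. x \<le> k) w))"
      using w by (metis distinct_card distinct_filter)
    also have "\<dots> \<le> card {1..k}"
      by (rule card_mono) (use w in auto)
    finally show ?thesis using True by (intro has_double_descent_short) simp
  next
    case False
    show ?thesis
    proof (cases "n < 3")
      case True
      then show ?thesis using w length_filter_le[of "\<lambda>x. x \<le> k" w]
        by (intro has_double_descent_short) simp
    next
      case False
      have "filter (\<lambda>x. x \<le> k) w = filter (\<lambda>x. x \<le> min k n) w"
        by (rule filter_cong) (use w in auto)
      moreover have "min k n \<in> {3..length w}" using False \<open>\<not> k < 3\<close> w by auto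
      ultimately show ?thesis using that unfolding simsun_def filt by metis
    qed
  qed
  then show ?thesis unfolding simsun_def simsun_word_def filt by blast
qed

text \<open>
  If a subword of small letters meets \<open>B\<close>, it has an ascent from \<open>x\<close> to its first letter from
  \<open>B\<close>, and the word splits there; otherwise it ends at \<open>x\<close>.
\<close>

lemma simsun_word_split:
  assumes "\<forall>y\<in>set A \<union> set B. x < y"
  shows "simsun_word (A @ x # B) \<longleftrightarrow> simsun_word (A @ [x]) \<and> simsun_word B"
proof -
  have "has_double_descent (filter (\<lambda>x. x \<le> k) (A @ x # B)) \<longleftrightarrow>
      has_double_descent (filter (\<lambda>x. x \<le> k) (A @ [x])) \<or>
      has_double_descent (filter (\<lambda>x. x \<le> k) B)" for k
  proof (cases "filter (\<lambda>x. x \<le> k) B")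
    case Nil
    then show ?thesis by (simp add: has_double_descent_short)
  next
    case (Cons y v)
    then have "y \<in> set B" "y \<le> k" using Cons_eq_filterD[OF Cons[symmetric]] by auto
    then have "x < y" using assms by blast
    then have "x \<le> k" using \<open>y \<le> k\<close> by simp
    then show ?thesis using Cons has_double_descent_ascent[OF \<open>x < y\<close>] by simp
  qed
  then show ?thesis unfolding simsun_word_def by blast
qed

text \<open>
  The sentinel \<open>s\<close> directly follows \<open>x\<close> when no letter of \<open>B\<close> is small enough to be kept.  This is
  harmless: \<open>B\<close> is nonempty and lies below \<open>A\<close>, so then no letter of \<open>A\<close> is kept either, and
  the descent from \<open>x\<close> to \<open>s\<close> is not part of a double descent.
\<close>

lemma simsun_word_sentinel_split:
  assumes x: "\<forall>y\<in>set A \<union> set B. x < y" and s: "s < x"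
    and AB: "\<forall>a\<in>set A. \<forall>b\<in>set B. b < a" and B: "B \<noteq> []"
  shows "simsun_word (A @ x # B @ [s]) \<longleftrightarrow> simsun_word (A @ [x]) \<and> simsun_word (B @ [s])"
proof -
  have "has_double_descent (filter (\<lambda>x. x \<le> k) (A @ x # B @ [s])) \<longleftrightarrow>
      has_double_descent (filter (\<lambda>x. x \<le> k) (A @ [x])) \<or>
      has_double_descent (filter (\<lambda>x. x \<le> k) (B @ [s]))" for k
  proof (cases "filter (\<lambda>x. x \<le> k) B")
    case Nil
    then have "\<not> hd B \<le> k" using B by (metis filter_empty_conv hd_in_set)
    then have "filter (\<lambda>x. x \<le> k) A = []"
      using AB B by (auto simp: filter_empty_conv) (meson hd_in_set less_imp_le order.trans)
    then show ?thesis using Nil by (simp add: has_double_descent_short)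
  next
    case (Cons y v)
    then have "y \<in> set B" "y \<le> k" using Cons_eq_filterD[OF Cons[symmetric]] by auto
    then have "x < y" using x by blast
    then have "x \<le> k" "s \<le> k" using \<open>y \<le> k\<close> s by simp_all
    then show ?thesis using Cons has_double_descent_ascent[OF \<open>x < y\<close>] by simp
  qed
  then show ?thesis unfolding simsun_word_def by blast
qed

lemma simsun_word_sentinel_end:
  assumes x: "\<forall>y\<in>set A. x < y" and s: "s < x"
  shows "simsun_word (A @ [x, s]) \<longleftrightarrow> A = []"
proof (cases A rule: rev_cases)
  case Nil
  then show ?thesis by (simp add: simsun_word_def has_double_descent_short)
next
  case (snoc A' a)
  let ?w = "A @ [x, s]"
  have "filter (\<lambda>x. x \<le> Max (set ?w)) ?w = ?w"
    by (rule filter_True) (metis List.finite_set Max_ge)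
  moreover have "has_double_descent ?w"
    unfolding has_double_descent_def
    using x s snoc by (intro exI[of _ "length A'"]) (simp add: nth_append)
  ultimately show ?thesis
    using snoc unfolding simsun_word_def by (metis snoc_eq_iff_butlast)
qed

section \<open>Counting\<close>

text \<open>
  In terms of generating functions, \<open>q\<close> is \<open>1 + z M\<close>, and the functional equation
  \<open>M = 1 + z M + z\<^sup>2 M\<^sup>2\<close> reads \<open>M = 1 + z q M\<close>.
\<close>

lemma sum_shifted_motzkin:
  assumes "q 0 = 1" and "\<And>i. q (Suc i) = motzkin i"
  shows "(\<Sum>i\<le>n. q (n - i) * motzkin i) = motzkin (Suc n)"
proof -
  have "(\<Sum>i\<le>n. q (n - i) * motzkin i) = motzkin n + (\<Sum>i<n. q (n - i) * motzkin i)"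
    by (simp add: assms(1) flip: lessThan_Suc_atMost)
  also have "(\<Sum>i<n. q (n - i) * motzkin i) = (\<Sum>i<n. motzkin i * motzkin (n - 1 - i))"
  proof (rule sum.cong)
    fix i assume "i \<in> {..<n}"
    then have "n - i = Suc (n - 1 - i)" by auto
    then show "q (n - i) * motzkin i = motzkin i * motzkin (n - 1 - i)"
      using assms(2)[of "n - 1 - i"] by simp
  qed simp
  finally show ?thesis by (simp add: motzkin_Suc)
qed

text \<open>
  The number \<open>q n\<close>.  The sentinel varies in the induction: the part before the minimum \<open>m\<close>
  has \<open>m\<close> itself as its sentinel, the part after it keeps \<open>s\<close>.
\<close>

lemma card_sentinel_avoiders:
  assumes "s < m"
  shows "card {w \<in> avoiders m n. simsun_word (w @ [s])} =
    (case n of 0 \<Rightarrow> 1 | Suc n' \<Rightarrow> motzkin n')"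
  using assms
proof (induction n arbitrary: m s rule: less_induct)
  case (less n)
  let ?q = "\<lambda>n. case n of 0 \<Rightarrow> 1 | Suc n' \<Rightarrow> motzkin n'"
  show ?case
  proof (cases n)
    case 0
    then show ?thesis
      by (simp add: avoiders_0 simsun_word_def has_double_descent_short cong: conj_cong)
  next
    case (Suc n')
    let ?R1 = "\<lambda>i A. if i = 0 then A = [] else simsun_word (A @ [m])"
    let ?R2 = "\<lambda>i B. if i = (0::nat) then True else simsun_word (B @ [s])"
    have "card {w \<in> avoiders m (Suc n'). simsun_word (w @ [s])} =
      (\<Sum>i\<le>n'. card {A \<in> avoiders (Suc m + i) (n' - i). ?R1 i A} *
               card {B \<in> avoiders (Suc m) i. ?R2 i B})"
    proof (rule card_avoiders_Suc)
      fix i A B assume A: "A \<in> avoiders (Suc m + i) (n' - i)" and B: "B \<in> avoiders (Suc m) i"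
      note AB = avoidersD[OF A] avoidersD[OF B]
      show "simsun_word ((A @ m # B) @ [s]) \<longleftrightarrow> ?R1 i A \<and> ?R2 i B"
      proof (cases "i = 0")
        case True
        then show ?thesis using AB simsun_word_sentinel_end[of A m s] less.prems by simp
      next
        case False
        have "\<forall>y\<in>set A \<union> set B. m < y" "\<forall>a\<in>set A. \<forall>b\<in>set B. b < a" "B \<noteq> []"
          using AB False by auto
        then show ?thesis
          using simsun_word_sentinel_split[of A B m s] less.prems False by simp
      qed
    qed
    also have "\<dots> = ?q (Suc n')"
    proof (cases n')
      case 0
      then show ?thesis by (simp add: avoiders_0 motzkin_0)
    next
      case (Suc n'')
      (* The term i = 0, with nothing after the minimum, vanishes unless the word has length 1. *)
      have "{A \<in> avoiders (Suc m) n'. A = []} = {}"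
        using Suc by (auto dest: avoidersD)
      then have "(\<Sum>i\<le>n'. card {A \<in> avoiders (Suc m + i) (n' - i). ?R1 i A} *
               card {B \<in> avoiders (Suc m) i. ?R2 i B}) =
        (\<Sum>i\<le>n''. card {A \<in> avoiders (Suc m + Suc i) (n'' - i). simsun_word (A @ [m])} *
               card {B \<in> avoiders (Suc m) (Suc i). simsun_word (B @ [s])})"
        unfolding Suc by (subst sum.atMost_Suc_shift) (simp del: add_Suc)
      also have "\<dots> = (\<Sum>i\<le>n''. ?q (n'' - i) * motzkin i)"
        using less.prems \<open>n = Suc n'\<close> Suc by (intro sum.cong) (simp_all add: less.IH)
      also have "\<dots> = motzkin (Suc n'')"
        by (rule sum_shifted_motzkin) simp_all
      finally show ?thesis using Suc by simp
    qed
    finally show ?thesis using Suc by simp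
  qed
qed

lemma card_simsun_avoiders: "card {w \<in> avoiders m n. simsun_word w} = motzkin n"
proof (induction n arbitrary: m rule: less_induct)
  case (less n)
  show ?case
  proof (cases n)
    case 0
    then show ?thesis
      by (simp add: avoiders_0 motzkin_0 simsun_word_def has_double_descent_short cong: conj_cong)
  next
    case (Suc n')
    have "card {w \<in> avoiders m (Suc n'). simsun_word w} =
      (\<Sum>i\<le>n'. card {A \<in> avoiders (Suc m + i) (n' - i). simsun_word (A @ [m])} *
               card {B \<in> avoiders (Suc m) i. simsun_word B})"
    proof (rule card_avoiders_Suc)
      fix i A B assume A: "A \<in> avoiders (Suc m + i) (n' - i)" and B: "B \<in> avoiders (Suc m) i"
      show "simsun_word (A @ m # B) \<longleftrightarrow> simsun_word (A @ [m]) \<and> simsun_word B"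
        by (rule simsun_word_split) (use avoidersD[OF A] avoidersD[OF B] in auto)
    qed
    also have "\<dots> = (\<Sum>i\<le>n'. (case n' - i of 0 \<Rightarrow> 1 | Suc j \<Rightarrow> motzkin j) * motzkin i)"
      using Suc by (intro sum.cong) (simp_all add: less.IH card_sentinel_avoiders)
    also have "\<dots> = motzkin (Suc n')"
      by (rule sum_shifted_motzkin) simp_all
    finally show ?thesis using Suc by simp
  qed
qed

theorem proposition4p1:
  fixes n :: nat
  shows "card (RS n [2, 1, 3]) = motzkin n"
proof -
  have "{1..n} = {1..<1 + n}" by auto
  then have "RS n [2, 1, 3] = {w \<in> avoiders 1 n. simsun_word w}"
    using simsun_iff_simsun_word[of _ n] by (auto simp: RS_def avoiders_def)
  then show ?thesis by (simp add: card_simsun_avoiders)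
qed

end
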